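(* Let $(X,d)$ be a metric space with unbounded distance function $d$, let $\mu$ be a Borel measure on $X$ with $\mu(X)=\infty$ and $0<\mu(U)<\infty$ for every nonempty bounded open subset $U\subseteq X$, and let $w$ be a radius-weight. Then for every $f\in\mathcal{F}_{loc}(X)$ and every $x\in X$, $$\lim_{p\to\infty} I_{p,w}f(x)=Mf(x)$$ (as an equality in $[0,\infty]$).
   Context: $\mathcal{B}_{x,r}$ denotes the open ball with center $x$ and radius $r>0$. $\mathcal{F}_{loc}(X)$ is the set of measurable real-valued functions $f$ on $X$ with $\int_U|f|\,d\mu<\infty$ for every bounded Borel set $U\subseteq X$. For $f\in\mathcal{F}_{loc}(X)$, the averaging-function is $Af(x,r):=\frac{1}{\mu(\mathcal{B}_{x,r})}\int_{\mathcal{B}_{x,r}}|f|\,d\mu$ for $(x,r)\in X\times(0,\infty)$, and the Hardy-Littlewood maximal-function is $Mf(x):=\sup_{r>0}Af(x,r)\in[0,\infty]$. A radius-weight is a nonnegative measurable function $w$ on $(0,\infty)$ with $\|w\|:=\int_0^\infty w(r)\,dr<\infty$ and $w\neq0$ almost everywhere (with respect to Lebesgue measure). For $1\le p<\infty$ the Hardy-Littlewood integral-function is $I_{p,w}f(x):=\big(\int_0^\infty w(r)(Af(x,r))^p\,dr\big)^{1/p}\in[0,\infty]$. *)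

theory Defs
  imports "HOL-Analysis.Analysis"
begin

definition F_loc :: "'a::metric_space measure \<Rightarrow> ('a \<Rightarrow> real) set" where
  "F_loc M = {f \<in> borel_measurable M.
     \<forall>U \<in> sets borel. bounded U \<longrightarrow> (\<integral>\<^sup>+y\<in>U. ennreal \<bar>f y\<bar> \<partial>M) < \<infinity>}"

definition averaging :: "'a::metric_space measure \<Rightarrow> ('a \<Rightarrow> real) \<Rightarrow> 'a \<Rightarrow> real \<Rightarrow> ennreal" where
  "averaging M f x r = (\<integral>\<^sup>+y\<in>ball x r. ennreal \<bar>f y\<bar> \<partial>M) / emeasure M (ball x r)"

definition HL_maximal :: "'a::metric_space measure \<Rightarrow> ('a \<Rightarrow> real) \<Rightarrow> 'a \<Rightarrow> ennreal" where
  "HL_maximal M f x = (SUP r\<in>{0<..}. averaging M f x r)"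

text \<open>A radius-weight need only be Lebesgue measurable; its values outside the
  positive half-line are irrelevant.\<close>

definition radius_weight :: "(real \<Rightarrow> real) \<Rightarrow> bool" where
  "radius_weight w \<longleftrightarrow>
     w \<in> borel_measurable (lebesgue_on {0<..}) \<and>
     (\<forall>r>0. 0 \<le> w r) \<and>
     (\<integral>\<^sup>+r. ennreal (w r) \<partial>(lebesgue_on {0<..})) < \<infinity> \<and>
     (AE r in lebesgue_on {0<..}. w r \<noteq> 0)"

text \<open>The extension of the real power to extended nonnegative reals,
  with \<open>\<infinity>\<close> raised to \<open>a\<close> equal to \<open>\<infinity>\<close>. It is meant for exponents \<open>a > 0\<close> only.\<close>

definition ennreal_powr :: "ennreal \<Rightarrow> real \<Rightarrow> ennreal" where
  "ennreal_powr t a = (if t = \<infinity> then \<infinity> else ennreal (enn2real t powr a))"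

definition HL_integral ::
  "'a::metric_space measure \<Rightarrow> real \<Rightarrow> (real \<Rightarrow> real) \<Rightarrow> ('a \<Rightarrow> real) \<Rightarrow> 'a \<Rightarrow> ennreal" where
  "HL_integral M p w f x = ennreal_powr
     (\<integral>\<^sup>+r. ennreal (w r) * ennreal_powr (averaging M f x r) p \<partial>(lebesgue_on {0<..})) (1 / p)"

end

theory Submission
  imports Defs
begin

text \<open>Enlarging the ball increases both the integral and the measure, and the integral over
  \<open>ball x r\<close> is left-continuous in \<open>r\<close>. Hence, if the average exceeds \<open>t\<close> at \<open>r\<^sub>0\<close>, it is at
  least \<open>t\<close> on a whole interval \<open>{r\<^sub>1..r\<^sub>0}\<close>, which has positive mass for the weight. So the
  maximal function is an essential supremum of the averages, and the classical convergence of
  \<open>L\<^sup>p\<close> norms to the \<open>L\<^sup>\<infinity>\<close> norm over a finite measure applies.\<close>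

lemma ennreal_powr_mono:
  assumes "s \<le> t" "0 \<le> a"
  shows "ennreal_powr s a \<le> ennreal_powr t a"
proof (cases "t = \<infinity>")
  case False
  then have "enn2real s \<le> enn2real t" "s \<noteq> \<infinity>"
    using assms by (auto simp: enn2real_mono top.not_eq_extremum top_unique)
  then show ?thesis
    using False assms by (auto simp: ennreal_powr_def intro!: ennreal_leI powr_mono2)
qed (simp add: ennreal_powr_def)

lemma ennreal_powr_cmult_powr:
  assumes "0 < c" "0 < p"
  shows "ennreal_powr (ennreal c * ennreal_powr t p) (1 / p) = ennreal (c powr (1 / p)) * t"
proof (cases "t = \<infinity>")
  case False
  then obtain s where s: "t = ennreal s" "0 \<le> s"
    by (cases t) auto
  have "(c * s powr p) powr (1 / p) = c powr (1 / p) * s"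
    using assms s by (simp add: powr_mult powr_powr)
  then show ?thesis
    using assms s by (simp add: ennreal_powr_def ennreal_mult[symmetric])
qed (use assms in \<open>simp add: ennreal_powr_def ennreal_mult_top\<close>)

lemma tendsto_powr_inverse_at_top:
  fixes c :: real and t :: ennreal
  assumes "0 < c" "t \<noteq> \<infinity>"
  shows "((\<lambda>p. ennreal (c powr (1 / p)) * t) \<longlongrightarrow> t) at_top"
proof -
  have "((\<lambda>p::real. 1 / p) \<longlongrightarrow> 0) at_top"
    using tendsto_inverse_0_at_top[OF filterlim_ident] by (simp add: inverse_eq_divide)
  then have "((\<lambda>p. c powr (1 / p)) \<longlongrightarrow> c powr 0) at_top"
    using assms by (intro tendsto_powr tendsto_const) auto
  then have "((\<lambda>p. ennreal (c powr (1 / p))) \<longlongrightarrow> ennreal 1) at_top"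
    using assms by (intro tendsto_ennrealI) simp
  then have "((\<lambda>p. ennreal (c powr (1 / p)) * t) \<longlongrightarrow> ennreal 1 * t) at_top"
    using assms by (intro tendsto_mult_ennreal tendsto_const) auto
  then show ?thesis by simp
qed

text \<open>Here \<open>upper\<close> and \<open>lower\<close> make \<open>S\<close> the essential
  supremum of \<open>g\<close> for the density \<open>v\<close>. The function \<open>g\<close>
  enters only through monotonicity of the integral, by comparison with constants on \<open>A\<close>
  and on the whole space.\<close>

lemma weighted_Lp_norm_tendsto:
  fixes v g :: "'b \<Rightarrow> ennreal"
  assumes v [measurable]: "v \<in> borel_measurable N"
    and fin: "(\<integral>\<^sup>+r. v r \<partial>N) < \<infinity>"
    and upper: "\<And>r. r \<in> space N \<Longrightarrow> g r \<le> S"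
    and lower: "\<And>t. t < S \<Longrightarrow>
      \<exists>A\<in>sets N. (\<forall>r\<in>A. t \<le> g r) \<and> 0 < (\<integral>\<^sup>+r\<in>A. v r \<partial>N)"
  shows "((\<lambda>p. ennreal_powr (\<integral>\<^sup>+r. v r * ennreal_powr (g r) p \<partial>N) (1 / p)) \<longlongrightarrow> S) at_top"
proof (rule order_tendstoI)
  fix a assume "a < S"
  \<comment> \<open>The gap between \<open>a\<close> and \<open>t\<close> absorbs the factor
    \<open>c powr (1 / p)\<close>, which is close to 1 for large \<open>p\<close>; being below
    \<open>S\<close>, the level \<open>t\<close> is also finite.\<close>
  then obtain t where t: "a < t" "t < S" using dense by blast
  obtain A where A [measurable]: "A \<in> sets N" and gA: "\<And>r. r \<in> A \<Longrightarrow> t \<le> g r"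
    and pos: "0 < (\<integral>\<^sup>+r\<in>A. v r \<partial>N)"
    using lower[OF t(2)] by blast
  have "(\<integral>\<^sup>+r\<in>A. v r \<partial>N) \<le> (\<integral>\<^sup>+r. v r \<partial>N)"
    by (intro nn_integral_mono) (auto split: split_indicator)
  then have "(\<integral>\<^sup>+r\<in>A. v r \<partial>N) < \<infinity>" using fin by (rule le_less_trans)
  then obtain c where c: "(\<integral>\<^sup>+r\<in>A. v r \<partial>N) = ennreal c" "0 < c"
    using pos by (cases "\<integral>\<^sup>+r\<in>A. v r \<partial>N") auto
  have "t \<noteq> \<infinity>" using t by auto
  then have "\<forall>\<^sub>F p in at_top. a < ennreal (c powr (1 / p)) * t"
    using order_tendstoD(1)[OF tendsto_powr_inverse_at_top[OF c(2)] t(1)] by simp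
  with eventually_gt_at_top[of 0]
  show "\<forall>\<^sub>F p in at_top. a < ennreal_powr (\<integral>\<^sup>+r. v r * ennreal_powr (g r) p \<partial>N) (1 / p)"
  proof eventually_elim
    case (elim p)
    have "ennreal c * ennreal_powr t p = (\<integral>\<^sup>+r. v r * indicator A r * ennreal_powr t p \<partial>N)"
      by (subst nn_integral_multc) (auto simp: c)
    also have "\<dots> \<le> (\<integral>\<^sup>+r. v r * ennreal_powr (g r) p \<partial>N)"
      using elim by (intro nn_integral_mono)
        (auto split: split_indicator intro!: mult_left_mono ennreal_powr_mono gA)
    finally have "ennreal (c powr (1 / p)) * t
        \<le> ennreal_powr (\<integral>\<^sup>+r. v r * ennreal_powr (g r) p \<partial>N) (1 / p)"
      using elim by (subst ennreal_powr_cmult_powr[OF c(2), symmetric])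
        (auto intro: ennreal_powr_mono)
    with elim show ?case by (auto intro: less_le_trans)
  qed
next
  fix a assume a: "S < a"
  \<comment> \<open>Adding 1 keeps \<open>c\<close> positive even for total mass 0, so that
    \<open>c powr (1 / p)\<close> tends to 1.\<close>
  define c where "c = enn2real (\<integral>\<^sup>+r. v r \<partial>N) + 1"
  have c: "0 < c" "(\<integral>\<^sup>+r. v r \<partial>N) \<le> ennreal c"
    using fin by (cases "\<integral>\<^sup>+r. v r \<partial>N"; auto simp: c_def intro!: add_nonneg_pos ennreal_leI)+
  have "S \<noteq> \<infinity>" using a by auto
  then have "\<forall>\<^sub>F p in at_top. ennreal (c powr (1 / p)) * S < a"
    using order_tendstoD(2)[OF tendsto_powr_inverse_at_top[OF c(1)] a] by simp
  with eventually_gt_at_top[of 0]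
  show "\<forall>\<^sub>F p in at_top. ennreal_powr (\<integral>\<^sup>+r. v r * ennreal_powr (g r) p \<partial>N) (1 / p) < a"
  proof eventually_elim
    case (elim p)
    have "(\<integral>\<^sup>+r. v r * ennreal_powr (g r) p \<partial>N) \<le> (\<integral>\<^sup>+r. v r * ennreal_powr S p \<partial>N)"
      using elim by (intro nn_integral_mono mult_left_mono ennreal_powr_mono upper) auto
    also have "\<dots> \<le> ennreal c * ennreal_powr S p"
      by (subst nn_integral_multc) (auto intro!: mult_right_mono c)
    finally have "ennreal_powr (\<integral>\<^sup>+r. v r * ennreal_powr (g r) p \<partial>N) (1 / p)
        \<le> ennreal (c powr (1 / p)) * S"
      using elim by (subst ennreal_powr_cmult_powr[OF c(1), symmetric])
        (auto intro: ennreal_powr_mono)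
    with elim show ?case by (auto intro: le_less_trans)
  qed
qed

text \<open>An open ball is the increasing union of the concentric balls of radii increasing
  strictly to \<open>r\<close>, so continuity from below of the measure with density
  \<open>h\<close> applies.\<close>

lemma nn_integral_ball_left_continuous:
  fixes h :: "'a::metric_space \<Rightarrow> ennreal"
  assumes [measurable_cong]: "sets M = sets borel"
    and [measurable]: "h \<in> borel_measurable M"
    and r: "0 < r" and less: "b < (\<integral>\<^sup>+y\<in>ball x r. h y \<partial>M)"
  obtains s where "0 < s" "s < r" "b < (\<integral>\<^sup>+y\<in>ball x s. h y \<partial>M)"
proof -
  \<comment> \<open>The shift by 2 makes the first radius \<open>r / 2\<close>; a shift by 1 would
    start at radius 0.\<close>
  define s where "s n = r - r / real (n + 2)" for n
  have s: "0 < s n" "s n < r" for n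
    using r by (auto simp: s_def field_simps add_pos_nonneg)
  have inc: "incseq (\<lambda>n. ball x (s n))"
    using r by (intro incseq_SucI subset_ball) (auto simp: s_def field_simps)
  have "s \<longlonglongrightarrow> r - 0"
    unfolding s_def
    using LIMSEQ_ignore_initial_segment[OF lim_const_over_n[of r], of 2]
    by (intro tendsto_diff tendsto_const) simp
  then have "\<exists>n. dist x y < s n" if "dist x y < r" for y
    using order_tendstoD(1)[of s r sequentially "dist x y"] that
    by (auto simp: eventually_sequentially)
  then have un: "(\<Union>n. ball x (s n)) = ball x r"
    using s(2) by (fastforce intro: less_trans)
  have "(\<integral>\<^sup>+y\<in>ball x r. h y \<partial>M) = emeasure (density M h) (\<Union>n. ball x (s n))"
    by (simp add: un emeasure_density)
  also have "\<dots> = (SUP n. emeasure (density M h) (ball x (s n)))"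
    using inc by (intro SUP_emeasure_incseq[symmetric]) auto
  finally obtain n where "b < (\<integral>\<^sup>+y\<in>ball x (s n). h y \<partial>M)"
    using less by (auto simp: less_SUP_iff emeasure_density)
  then show thesis using that s by blast
qed

text \<open>Left continuity moves the strict bound from the integral over \<open>ball x r\<close> to
  that over \<open>ball x s\<close>, keeping the measure of the largest ball. For \<open>q\<close>
  in between, the integral is at least that over the smallest ball and the measure at most that of
  the largest.\<close>

lemma averaging_ge_on_interval:
  fixes M :: "'a::metric_space measure"
  assumes sets: "sets M = sets borel" and f: "f \<in> borel_measurable M"
    and pos_fin: "\<And>r. 0 < r \<Longrightarrow> 0 < emeasure M (ball x r) \<and> emeasure M (ball x r) < \<infinity>"
    and r: "0 < r" and less: "t < averaging M f x r"
  obtains s where "0 < s" "s < r" "\<And>q. q \<in> {s..r} \<Longrightarrow> t \<le> averaging M f x q"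
proof -
  let ?F = "\<lambda>q. \<integral>\<^sup>+y\<in>ball x q. ennreal \<bar>f y\<bar> \<partial>M"
  \<comment> \<open>Cancellation in \<open>ennreal\<close> needs the measure of the ball to be
    neither 0 nor \<infinity>.\<close>
  have cancel: "t * emeasure M (ball x q) / emeasure M (ball x q) = t" if "0 < q" for q
    using pos_fin[OF that] 
      by (intro ennreal_mult_divide_eq) auto
  have "t * emeasure M (ball x r) < ?F r"
  proof (rule ccontr)
    assume "\<not> ?thesis"
    then have "averaging M f x r \<le> t * emeasure M (ball x r) / emeasure M (ball x r)"
      unfolding averaging_def by (intro divide_right_mono_ennreal) simp
    with less cancel[OF r] show False by simp
  qed
  moreover have "(\<lambda>y. ennreal \<bar>f y\<bar>) \<in> borel_measurable M" using f by measurable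
  ultimately obtain s where s: "0 < s" "s < r" "t * emeasure M (ball x r) < ?F s"
    using nn_integral_ball_left_continuous[OF sets _ r] by metis
  have "t \<le> averaging M f x q" if q: "q \<in> {s..r}" for q
  proof -
    have "t * emeasure M (ball x q) \<le> t * emeasure M (ball x r)"
      using q by (intro mult_left_mono emeasure_mono subset_ball) (auto simp: sets)
    also have "\<dots> \<le> ?F s" using s(3) by simp
    also have "\<dots> \<le> ?F q"
      using q by (intro nn_integral_mono) (auto split: split_indicator)
    finally show ?thesis
      using q s(1) cancel[of q] divide_right_mono_ennreal[of _ "?F q" "emeasure M (ball x q)"]
      unfolding averaging_def by fastforce
  qed
  with s that show thesis by blast
qed

text \<open>If the integral were 0, the weight would vanish almost everywhere on
  \<open>{s..r}\<close>. Since it is nonzero almost everywhere, the interval would be null, against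
  its length \<open>r - s > 0\<close>.\<close>

lemma radius_weight_interval_pos:
  assumes w: "radius_weight w" and s: "0 < s" "s < r"
  shows "0 < (\<integral>\<^sup>+q\<in>{s..r}. ennreal (w q) \<partial>(lebesgue_on {0<..}))"
proof (rule ccontr)
  let ?L = "lebesgue_on {0::real<..}"
  have [measurable]: "w \<in> borel_measurable ?L" using w by (simp add: radius_weight_def)
  have sub: "{s..r} \<subseteq> {0<..}" using s by auto
  then have [measurable]: "{s..r} \<in> sets ?L" by (simp add: sets_restrict_space_iff)
  assume "\<not> ?thesis"
  then have "AE q in ?L. ennreal (w q) * indicator {s..r} q = 0"
    by (subst nn_integral_0_iff_AE[symmetric]) auto
  moreover have "AE q in ?L. w q \<noteq> 0" using w by (simp add: radius_weight_def)
  \<comment> \<open>\<open>AE_space\<close> supplies \<open>0 < q\<close>, where the weight is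
    nonnegative; this matters because \<open>ennreal\<close> also sends negative values to
    0.\<close>
  ultimately have "AE q in ?L. q \<notin> {s..r}"
    using AE_space
  proof eventually_elim
    case (elim q)
    then have "0 < w q" using w by (auto simp: radius_weight_def less_le)
    with elim show ?case by (auto split: split_indicator_asm)
  qed
  then have "emeasure ?L {s..r} = 0"
    using sub by (subst (asm) AE_iff_measurable[of "{s..r}"]) auto
  then show False
    using s sub by (simp add: emeasure_restrict_space)
qed

theorem theorem2p4:
  fixes M :: "'a::metric_space measure"
    and w :: "real \<Rightarrow> real"
    and f :: "'a \<Rightarrow> real"
    and x :: 'a
  assumes unbounded_dist: "\<not> bounded (UNIV :: 'a set)"
    and borel_M: "sets M = sets borel"
    and infinite_M: "emeasure M (UNIV :: 'a set) = \<infinity>"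
    and pos_finite_M:
      "\<And>U :: 'a set. open U \<Longrightarrow> bounded U \<Longrightarrow> U \<noteq> {} \<Longrightarrow> 0 < emeasure M U \<and> emeasure M U < \<infinity>"
    and weight: "radius_weight w"
    and f_loc: "f \<in> F_loc M"
  shows "((\<lambda>p::real. HL_integral M p w f x) \<longlongrightarrow> HL_maximal M f x) at_top"
  unfolding HL_integral_def
proof (rule weighted_Lp_norm_tendsto)
  let ?L = "lebesgue_on {0::real<..}"
  show "(\<lambda>r. ennreal (w r)) \<in> borel_measurable ?L" "(\<integral>\<^sup>+r. ennreal (w r) \<partial>?L) < \<infinity>"
    using weight by (auto simp: radius_weight_def)
  show "averaging M f x r \<le> HL_maximal M f x" if "r \<in> space ?L" for r
    unfolding HL_maximal_def using that by (intro SUP_upper) simp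
  \<comment> \<open>A radius whose average exceeds \<open>t\<close> exists because the maximal
    function is a supremum; the required set \<open>A\<close> is then an interval ending at that
    radius.\<close>
  fix t assume "t < HL_maximal M f x"
  then obtain r where r: "0 < r" "t < averaging M f x r"
    by (auto simp: HL_maximal_def less_SUP_iff)
  have f: "f \<in> borel_measurable M" using f_loc by (simp add: F_loc_def)
  have "0 < emeasure M (ball x q) \<and> emeasure M (ball x q) < \<infinity>" if "0 < q" for q
    using that by (intro pos_finite_M) auto
  then obtain s where s: "0 < s" "s < r" "\<And>q. q \<in> {s..r} \<Longrightarrow> t \<le> averaging M f x q"
    using averaging_ge_on_interval[OF borel_M f _ r] by blast
  have "{s..r} \<in> sets ?L" using s by (auto simp: sets_restrict_space_iff)
  with s radius_weight_interval_pos[OF weight s(1,2)]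
  show "\<exists>A\<in>sets ?L. (\<forall>q\<in>A. t \<le> averaging M f x q) \<and> 0 < (\<integral>\<^sup>+q\<in>A. ennreal (w q) \<partial>?L)"
    by blast
qed

end
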